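(* Every randomized online algorithm for All-or-One Paging with cache size $k$ has competitive ratio at least $2H_k-1$, where $H_k=\sum_{i=1}^k1/i$.
   Context: All-or-One Paging with $k$ slots: each request is either general, $(p,\ast)$, satisfied by a configuration holding page $p$ in any slot, or specific, $(p,j)$ with $j\in[k]$, satisfied only if slot $j$ holds $p$. A configuration assigns to each slot one page or nothing; a solution is a sequence of configurations satisfying the requests in order; its cost is the number of retrievals (page $p$ retrieved in slot $s$ at time $t$ if $C_t$ assigns $p$ to $s$ but $C_{t-1}$ does not, or $t=1$). A randomized online algorithm is $c$-competitive if its expected cost is at most $c\cdot\mathrm{OPT}(\sigma)+b$ for every request sequence $\sigma$, with $b$ a constant independent of $\sigma$. *)

theory Defs
  imports "HOL-Probability.Probability"
begin

datatype 'p request = General 'p | Specific 'p nat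

primrec valid_request :: "nat \<Rightarrow> 'p request \<Rightarrow> bool" where
  "valid_request k (General p) \<longleftrightarrow> True"
| "valid_request k (Specific p j) \<longleftrightarrow> j \<in> {1..k}"

definition request_sequence :: "nat \<Rightarrow> 'p request list \<Rightarrow> bool" where
  "request_sequence k \<sigma> \<longleftrightarrow> (\<forall>r \<in> set \<sigma>. valid_request k r)"

text \<open>The slots are \<open>1, \<dots>, k\<close>; the values of a configuration at other
  arguments are irrelevant.\<close>

type_synonym 'p config = "nat \<Rightarrow> 'p option"

primrec satisfies :: "nat \<Rightarrow> 'p config \<Rightarrow> 'p request \<Rightarrow> bool" where
  "satisfies k C (General p) \<longleftrightarrow> (\<exists>s \<in> {1..k}. C s = Some p)"
| "satisfies k C (Specific p j) \<longleftrightarrow> C j = Some p"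

definition is_solution :: "nat \<Rightarrow> 'p request list \<Rightarrow> 'p config list \<Rightarrow> bool" where
  "is_solution k \<sigma> Cs \<longleftrightarrow>
     length Cs = length \<sigma> \<and> (\<forall>t < length \<sigma>. satisfies k (Cs ! t) (\<sigma> ! t))"

text \<open>Time steps are numbered from \<open>0\<close>, so the first configuration is \<open>Cs ! 0\<close>.\<close>

definition retrieved :: "'p config list \<Rightarrow> nat \<Rightarrow> nat \<Rightarrow> 'p \<Rightarrow> bool" where
  "retrieved Cs t s p \<longleftrightarrow>
     (Cs ! t) s = Some p \<and> (t = 0 \<or> (Cs ! (t - 1)) s \<noteq> Some p)"

definition cost :: "nat \<Rightarrow> 'p config list \<Rightarrow> nat" where
  "cost k Cs = card {(t, s, p). t < length Cs \<and> s \<in> {1..k} \<and> retrieved Cs t s p}"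

definition OPT :: "nat \<Rightarrow> 'p request list \<Rightarrow> nat" where
  "OPT k \<sigma> = Inf {cost k Cs | Cs. is_solution k \<sigma> Cs}"

text \<open>A deterministic online algorithm maps the requests seen so far, the current one
  included, to the configuration that serves the current request.\<close>

type_synonym 'p online_alg = "'p request list \<Rightarrow> 'p config"

definition run :: "'p online_alg \<Rightarrow> 'p request list \<Rightarrow> 'p config list" where
  "run A \<sigma> = map (\<lambda>t. A (take (Suc t) \<sigma>)) [0..<length \<sigma>]"

text \<open>A randomized online algorithm is a deterministic one chosen at random according to a
  probability space \<open>M\<close>. As \<open>cost k (run (A \<omega>) \<sigma>) \<le> k * length \<sigma>\<close>, measurability of the cost
  already makes it integrable, so the integral below is the true expectation.\<close>

definition randomized_online_algorithm ::
    "nat \<Rightarrow> 'w measure \<Rightarrow> ('w \<Rightarrow> 'p online_alg) \<Rightarrow> bool" where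
  "randomized_online_algorithm k M A \<longleftrightarrow>
     prob_space M \<and>
     (\<forall>\<sigma>. request_sequence k \<sigma> \<longrightarrow>
        (\<forall>\<omega> \<in> space M. is_solution k \<sigma> (run (A \<omega>) \<sigma>)) \<and>
        (\<lambda>\<omega>. real (cost k (run (A \<omega>) \<sigma>))) \<in> borel_measurable M)"

definition expected_cost ::
    "nat \<Rightarrow> 'w measure \<Rightarrow> ('w \<Rightarrow> 'p online_alg) \<Rightarrow> 'p request list \<Rightarrow> real" where
  "expected_cost k M A \<sigma> = (\<integral>\<omega>. real (cost k (run (A \<omega>) \<sigma>)) \<partial>M)"

definition competitive ::
    "nat \<Rightarrow> 'w measure \<Rightarrow> ('w \<Rightarrow> 'p online_alg) \<Rightarrow> real \<Rightarrow> bool" where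
  "competitive k M A c \<longleftrightarrow>
     (\<exists>b :: real. \<forall>\<sigma>. request_sequence k \<sigma> \<longrightarrow>
        expected_cost k M A \<sigma> \<le> c * real (OPT k \<sigma>) + b)"

text \<open>The ratio is \<open>\<infinity>\<close> if the algorithm is not \<open>c\<close>-competitive for any \<open>c\<close>.\<close>

definition competitive_ratio ::
    "nat \<Rightarrow> 'w measure \<Rightarrow> ('w \<Rightarrow> 'p online_alg) \<Rightarrow> ereal" where
  "competitive_ratio k M A = Inf {ereal c | c. competitive k M A c}"

end

theory Submission
  imports Defs "HOL-Library.Sublist"
begin

text \<open>By averaging (Yao's principle), it suffices to bound the expected cost of a deterministic
  algorithm on a random request sequence. In a phase that starts with page \<open>c j\<close> in slot \<open>j\<close>, a
  page \<open>p\<close> outside the cache is requested generally; then the slots are taken in a uniformly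
  random order, and \<open>(c j, j)\<close> is requested for all slots but the last, each time repeating all
  requests of the phase until the algorithm satisfies them simultaneously. The optimal solution
  puts \<open>p\<close> into the last slot and pays 1 per phase. The algorithm pays 1 for the first retrieval of
  \<open>p\<close>; whenever \<open>i\<close> slots are left, the next one holds \<open>p\<close> with probability at least \<open>1 / i\<close>, and
  then both \<open>c j\<close> and \<open>p\<close> have to be retrieved. The total is \<open>1 + 2 (1/k + \<dots> + 1/2)\<close>.\<close>

section \<open>Cost as a sum of retrievals between consecutive configurations\<close>

definition retrievals :: "nat \<Rightarrow> 'p config \<Rightarrow> 'p config \<Rightarrow> nat" where
  "retrievals k C D = card {s \<in> {1..k}. D s \<noteq> None \<and> D s \<noteq> C s}"

text \<open>The empty cache stands in for the configuration before the first request, since at that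
  time \<open>cost\<close> counts every page present as retrieved.\<close>

definition last_config :: "'p config list \<Rightarrow> 'p config" where
  "last_config Cs = (if Cs = [] then (\<lambda>_. None) else last Cs)"

lemma retrievals_self [simp]: "retrievals k C C = 0"
  by (simp add: retrievals_def)

lemma retrievals_le: "retrievals k C D \<le> k"
proof -
  have "retrievals k C D \<le> card {1..k}"
    unfolding retrievals_def by (rule card_mono) auto
  then show ?thesis by simp
qed

lemma retrievals_triangle: "retrievals k C E \<le> retrievals k C D + retrievals k D E"
proof -
  have "{s \<in> {1..k}. E s \<noteq> None \<and> E s \<noteq> C s} \<subseteq>
      {s \<in> {1..k}. D s \<noteq> None \<and> D s \<noteq> C s} \<union> {s \<in> {1..k}. E s \<noteq> None \<and> E s \<noteq> D s}"
    by auto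
  then have "retrievals k C E \<le> card ({s \<in> {1..k}. D s \<noteq> None \<and> D s \<noteq> C s} \<union>
      {s \<in> {1..k}. E s \<noteq> None \<and> E s \<noteq> D s})"
    unfolding retrievals_def by (intro card_mono) auto
  also have "\<dots> \<le> retrievals k C D + retrievals k D E"
    unfolding retrievals_def by (rule card_Un_le)
  finally show ?thesis .
qed

text \<open>Slots may be emptied for free, so \<open>D\<close> may lack pages of \<open>C\<close>,
  but each page in \<open>D\<close> was already in the same slot of \<open>C\<close>.\<close>

lemma satisfies_if_no_retrievals:
  assumes "retrievals k C D = 0" "satisfies k D q" "valid_request k q"
  shows "satisfies k C q"
proof -
  have "{s \<in> {1..k}. D s \<noteq> None \<and> D s \<noteq> C s} = {}"
    using assms(1) unfolding retrievals_def by simp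
  then have eq: "C s = Some p" if "s \<in> {1..k}" "D s = Some p" for s p
  proof -
    have "s \<notin> {s \<in> {1..k}. D s \<noteq> None \<and> D s \<noteq> C s}"
      using \<open>_ = {}\<close> by (simp only: empty_iff not_False_eq_True)
    then show ?thesis using that by auto
  qed
  show ?thesis
  proof (cases q)
    case (General p)
    show ?thesis using assms(2) eq unfolding General satisfies.simps by blast
  next
    case (Specific p j)
    show ?thesis using assms(2,3) eq unfolding Specific satisfies.simps valid_request.simps by blast
  qed
qed

lemma cost_Nil [simp]: "cost k [] = 0"
  unfolding cost_def by (rule card_eq_0_iff[THEN iffD2]) auto

lemma cost_snoc: "cost k (Cs @ [C]) = cost k Cs + retrievals k (last_config Cs) C"
proof -
  let ?X = "\<lambda>Cs :: 'a config list. {(t, s, p). t < length Cs \<and> s \<in> {1..k} \<and> retrieved Cs t s p}"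
  let ?R = "{s \<in> {1..k}. C s \<noteq> None \<and> C s \<noteq> last_config Cs s}"
  let ?f = "\<lambda>s. (length Cs, s, the (C s))"
  have old: "retrieved (Cs @ [C]) t s p \<longleftrightarrow> retrieved Cs t s p" if "t < length Cs" for t s p
    using that by (auto simp: retrieved_def nth_append)
  have new: "retrieved (Cs @ [C]) (length Cs) s p \<longleftrightarrow> C s = Some p \<and> C s \<noteq> last_config Cs s" for s p
    by (auto simp: retrieved_def nth_append last_config_def last_conv_nth)
  \<comment> \<open>The triples at the new time \<open>length Cs\<close> are indexed by their slots,
    since the slot determines the page.\<close>
  have "?X (Cs @ [C]) = ?X Cs \<union> ?f ` ?R"
  proof (intro equalityI subsetI)
    fix x assume "x \<in> ?X (Cs @ [C])"
    then obtain t s p where x: "x = (t, s, p)" "t < Suc (length Cs)" "s \<in> {1..k}"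
      "retrieved (Cs @ [C]) t s p" by auto
    show "x \<in> ?X Cs \<union> ?f ` ?R"
    proof (cases "t = length Cs")
      case True
      then have "s \<in> ?R" "x = ?f s" using x new[of s p] by auto
      then show ?thesis by blast
    next
      case False
      then show ?thesis using x old[of t s p] by auto
    qed
  next
    fix x assume "x \<in> ?X Cs \<union> ?f ` ?R"
    then show "x \<in> ?X (Cs @ [C])" by (auto simp: old new)
  qed
  moreover have "finite (?X Cs)"
  proof (rule finite_subset)
    show "?X Cs \<subseteq> (\<lambda>(t, s). (t, s, the ((Cs ! t) s))) ` ({..<length Cs} \<times> {1..k})"
      by (force simp: retrieved_def)
  qed simp
  moreover have "?X Cs \<inter> ?f ` ?R = {}" by auto
  moreover have "card (?f ` ?R) = card ?R" by (rule card_image) (auto simp: inj_on_def)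
  ultimately show ?thesis
    by (simp add: cost_def retrievals_def card_Un_disjoint)
qed

lemma last_config_snoc [simp]: "last_config (Cs @ [C]) = C"
  by (simp add: last_config_def)

section \<open>Deterministic online algorithms and repeated rounds\<close>

lemma run_Nil [simp]: "run A [] = []"
  by (simp add: run_def)

lemma run_snoc: "run A (h @ [r]) = run A h @ [A (h @ [r])]"
  by (simp add: run_def)

lemma request_sequence_append [simp]:
  "request_sequence k (xs @ ys) \<longleftrightarrow> request_sequence k xs \<and> request_sequence k ys"
  by (auto simp: request_sequence_def)

lemma request_sequence_concat_replicate:
  "request_sequence k B \<Longrightarrow> request_sequence k (concat (replicate n B))"
  by (auto simp: request_sequence_def)

text \<open>By the triangle inequality, detours never make it cheaper to get from one configuration
  to another. Two checkpoints can thus be compared without looking at what happens between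
  them.\<close>

lemma cost_run_prefix:
  assumes "prefix h h'"
  shows "cost k (run A h) + retrievals k (last_config (run A h)) (last_config (run A h'))
           \<le> cost k (run A h')"
proof -
  obtain xs where "h' = h @ xs" using assms by (auto simp: prefix_def)
  moreover have "cost k (run A h) + retrievals k (last_config (run A h)) (last_config (run A (h @ xs)))
           \<le> cost k (run A (h @ xs))"
  proof (induction xs rule: rev_induct)
    case (snoc x xs)
    then show ?case
      using retrievals_triangle[of k "last_config (run A h)" "A (h @ xs @ [x])" "last_config (run A (h @ xs))"]
      by (simp add: run_snoc cost_snoc flip: append_assoc)
  qed simp
  ultimately show ?thesis by simp
qed

lemma cost_run_mono: "prefix h h' \<Longrightarrow> cost k (run A h) \<le> cost k (run A h')"
  using cost_run_prefix[of h h' k A] by simp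

definition serves :: "nat \<Rightarrow> 'p online_alg \<Rightarrow> bool" where
  "serves k A \<longleftrightarrow> (\<forall>\<sigma>. request_sequence k \<sigma> \<longrightarrow> is_solution k \<sigma> (run A \<sigma>))"

lemma serves_last:
  assumes "serves k A" "request_sequence k (h @ [r])"
  shows "satisfies k (last_config (run A (h @ [r]))) r"
proof -
  have "is_solution k (h @ [r]) (run A (h @ [r]))"
    using assms by (simp add: serves_def)
  then have "satisfies k (run A (h @ [r]) ! length h) ((h @ [r]) ! length h)"
    unfolding is_solution_def by force
  moreover have "length (run A h) = length h" by (simp add: run_def)
  ultimately show ?thesis by (simp add: run_snoc nth_append)
qed

text \<open>A round of requests that causes no retrieval is already satisfied as a whole by the
  configuration before the round.\<close>

lemma repeated_block:
  assumes "serves k A" "request_sequence k h" "request_sequence k B"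
  shows "cost k (run A h) + N \<le> cost k (run A (h @ concat (replicate N B))) \<or>
    (\<exists>h'. prefix h h' \<and> prefix h' (h @ concat (replicate N B)) \<and>
          (\<forall>q \<in> set B. satisfies k (last_config (run A h')) q))"
proof (induction N)
  case (Suc N)
  define g where "g = h @ concat (replicate N B)"
  have rep: "concat (replicate (Suc N) B) = concat (replicate N B) @ B"
    by (simp flip: replicate_append_same)
  have g': "h @ concat (replicate (Suc N) B) = g @ B"
    unfolding rep g_def by simp
  have val: "request_sequence k (g @ B)"
    using assms unfolding g_def by (simp add: request_sequence_concat_replicate)
  from Suc consider "cost k (run A h) + N \<le> cost k (run A g)"
    | h' where "prefix h h'" "prefix h' g" "\<forall>q \<in> set B. satisfies k (last_config (run A h')) q"
    unfolding g_def by blast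
  then show ?case
  proof cases
    case 1
    show ?thesis
    \<comment> \<open>Costs are integers, so a round that is not free costs at least 1.\<close>
    proof (cases "cost k (run A (g @ B)) \<le> cost k (run A g)")
      case True
      have "satisfies k (last_config (run A g)) q" if "q \<in> set B" for q
      proof -
        obtain B1 B2 where B: "B = B1 @ q # B2" using \<open>q \<in> set B\<close> by (meson split_list)
        have "prefix (g @ B1 @ [q]) (g @ B)" "prefix g (g @ B1 @ [q])" using B by auto
        then have "retrievals k (last_config (run A g)) (last_config (run A (g @ B1 @ [q]))) = 0"
          using cost_run_prefix[of g "g @ B1 @ [q]" k A] cost_run_mono[of "g @ B1 @ [q]" "g @ B" k A]
            True by linarith
        moreover have "satisfies k (last_config (run A (g @ B1 @ [q]))) q"
          using serves_last[OF assms(1), of "g @ B1" q] val B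
          by (auto simp: request_sequence_def)
        ultimately show ?thesis
          by (rule satisfies_if_no_retrievals) (use val that in \<open>auto simp: request_sequence_def\<close>)
      qed
      then show ?thesis unfolding g' by (intro disjI2 exI[of _ g]) (auto simp: g_def)
    next
      case False
      then show ?thesis using 1 unfolding g' by simp
    qed
  next
    case 2
    then show ?thesis unfolding g' by (meson prefix_order.trans prefixI)
  qed
qed simp

section \<open>The random request sequence\<close>

text \<open>Throughout a phase, \<open>c j\<close> is the page of slot \<open>j\<close> at the start of the phase, \<open>c 0\<close> is the
  page to be brought in, and \<open>R\<close> is the set of slots not yet requested.\<close>

definition block :: "nat \<Rightarrow> (nat \<Rightarrow> 'p) \<Rightarrow> nat set \<Rightarrow> 'p request list" where
  "block k c R = General (c 0) # map (\<lambda>j. Specific (c j) j) (sorted_list_of_set ({1..k} - R))"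

definition blocks :: "nat \<Rightarrow> nat \<Rightarrow> (nat \<Rightarrow> 'p) \<Rightarrow> nat set \<Rightarrow> 'p request list" where
  "blocks k N c R = concat (replicate N (block k c R))"

lemma set_block: "set (block k c R) = insert (General (c 0)) ((\<lambda>j. Specific (c j) j) ` ({1..k} - R))"
  by (simp add: block_def)

lemma request_sequence_blocks: "request_sequence k (blocks k N c R)"
  unfolding blocks_def
  by (rule request_sequence_concat_replicate) (auto simp: request_sequence_def set_block)

text \<open>Index 0 carries the page outside the cache, so evicting the page of slot
  \<open>s\<close> in its favour composes \<open>c\<close> with a transposition. This keeps
  \<open>c\<close> injective.\<close>

definition swap_in :: "(nat \<Rightarrow> 'p) \<Rightarrow> nat \<Rightarrow> nat \<Rightarrow> 'p" where
  "swap_in c s = c(0 := c s, s := c 0)"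

lemma swap_in_simps [simp]:
  "swap_in c s s = c 0" "swap_in c s 0 = c s" "j \<noteq> 0 \<Longrightarrow> j \<noteq> s \<Longrightarrow> swap_in c s j = c j"
  by (auto simp: swap_in_def)

lemma inj_swap_in: "inj c \<Longrightarrow> inj (swap_in c s)"
  by (auto simp: inj_def swap_in_def)

text \<open>\<open>T\<close> counts the phases after the current one, and \<open>R\<close> has \<open>r + 1\<close> elements. The page
  evicted by the optimal solution at the end of a phase is the new page of the next phase.\<close>

fun adversary :: "nat \<Rightarrow> nat \<Rightarrow> nat \<Rightarrow> nat \<Rightarrow> (nat \<Rightarrow> 'p) \<Rightarrow> nat set \<Rightarrow> 'p request list \<Rightarrow>
    'p request list pmf" where
  "adversary k N T (Suc r) c R h =
     bind_pmf (pmf_of_set R) (\<lambda>j. adversary k N T r c (R - {j}) (h @ blocks k N c (R - {j})))"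
| "adversary k N 0 0 c R h = return_pmf h"
| "adversary k N (Suc T) 0 c R h =
     adversary k N T (k - 1) (swap_in c (the_elem R)) {1..k}
       (h @ blocks k N (swap_in c (the_elem R)) {1..k})"

text \<open>The finite support turns expectations over the adversary into finite sums and makes
  every cost integrable.\<close>

lemma adversary_support:
  assumes "k \<ge> 1" "R \<subseteq> {1..k}" "card R = Suc r" "request_sequence k h"
  shows "finite (set_pmf (adversary k N T r c R h)) \<and>
    (\<forall>\<sigma> \<in> set_pmf (adversary k N T r c R h). prefix h \<sigma> \<and> request_sequence k \<sigma>)"
  using assms
proof (induction k N T r c R h rule: adversary.induct)
  case (1 k N T r c R h)
  have R: "finite R" "R \<noteq> {}" using 1(3,4) by (auto intro: finite_subset)
  have "finite (set_pmf (adversary k N T r c (R - {j}) (h @ blocks k N c (R - {j})))) \<and>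
    (\<forall>\<sigma> \<in> set_pmf (adversary k N T r c (R - {j}) (h @ blocks k N c (R - {j}))).
       prefix (h @ blocks k N c (R - {j})) \<sigma> \<and> request_sequence k \<sigma>)" if "j \<in> R" for j
    using that R 1(2-5) by (intro 1(1)) (auto simp: request_sequence_blocks)
  then show ?case using R by (auto dest: append_prefixD)
next
  case (2 k N c R h)
  then show ?case by simp
next
  case (3 k N T c R h)
  then show ?case by (auto simp: request_sequence_blocks dest: append_prefixD)
qed

text \<open>Every generated sequence extends \<open>h\<close>, and costs never decrease. This
  settles the case that a repeated block has already cost enough.\<close>

lemma adversary_expectation_ge:
  assumes "k \<ge> 1" "R \<subseteq> {1..k}" "card R = Suc r" "request_sequence k h"
    and "x \<le> real (cost k (run A h))"
  shows "x \<le> measure_pmf.expectation (adversary k N T r c R h) (\<lambda>\<sigma>. real (cost k (run A \<sigma>)))"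
proof (rule measure_pmf.integral_ge_const)
  note supp = adversary_support[OF assms(1-4), of N T c]
  show "integrable (measure_pmf (adversary k N T r c R h)) (\<lambda>\<sigma>. real (cost k (run A \<sigma>)))"
    using supp by (intro integrable_measure_pmf_finite) auto
  show "AE \<sigma> in measure_pmf (adversary k N T r c R h). x \<le> real (cost k (run A \<sigma>))"
    using supp assms(5) cost_run_mono[of h _ k A] by (intro AE_pmfI) fastforce
qed

section \<open>Expected cost of a deterministic algorithm\<close>

lemma harm_ge_one: "n \<ge> 1 \<Longrightarrow> harm n \<ge> (1::real)"
  using harm_mono[of 1 n, where 'a = real] by (simp add: harm_expand)

abbreviation holders :: "nat \<Rightarrow> 'p config \<Rightarrow> 'p \<Rightarrow> nat set" where
  "holders k C p \<equiv> {s \<in> {1..k}. C s = Some p}"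

lemma card_holders_le_retrievals:
  assumes "holders k C p = {}"
  shows "card (holders k D p) \<le> retrievals k C D"
  unfolding retrievals_def using assms by (intro card_mono) force+

text \<open>The factor 2 has two sources: if slot \<open>j\<close> held \<open>p\<close>, then
  bringing in \<open>q\<close> is itself a retrieval, and it destroys a copy of \<open>p\<close>, so
  one copy fewer can be carried over from \<open>C\<close> to \<open>D\<close>.\<close>

lemma retrievals_ge_holders:
  assumes "j \<in> {1..k}" "D j = Some q" "q \<noteq> p"
  shows "card (holders k D p) + 2 * of_bool (j \<in> holders k C p) \<le> retrievals k C D + card (holders k C p)"
proof -
  let ?S = "holders k C p" and ?S' = "holders k D p"
  have fin: "finite ?S" "finite ?S'" by auto
  have j: "j \<notin> ?S'" using assms by auto
  have "card (?S' - ?S) + of_bool (j \<in> ?S) \<le> retrievals k C D"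
  proof (cases "j \<in> ?S")
    case True
    have "card (insert j (?S' - ?S)) \<le> retrievals k C D"
      unfolding retrievals_def using assms True by (intro card_mono) auto
    then show ?thesis using True j using fin by simp
  next
    case False
    have "card (?S' - ?S) \<le> retrievals k C D"
      unfolding retrievals_def by (intro card_mono) auto
    then show ?thesis using False by auto
  qed
  moreover have "card (?S' \<inter> ?S) + of_bool (j \<in> ?S) \<le> card ?S"
  proof (cases "j \<in> ?S")
    case True
    have "card (insert j (?S' \<inter> ?S)) \<le> card ?S" using True by (intro card_mono) auto
    then show ?thesis using True j using fin by simp
  next
    case False
    have "card (?S' \<inter> ?S) \<le> card ?S" by (intro card_mono) auto
    then show ?thesis using False by auto
  qed
  moreover have "card ?S' = card (?S' - ?S) + card (?S' \<inter> ?S)"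
    using card_Diff_subset_Int[of ?S' ?S] card_mono[of ?S' "?S' \<inter> ?S"] fin by auto
  ultimately show ?thesis by simp
qed

text \<open>The slots outside \<open>R\<close> are occupied by their own pages, which differ from
  \<open>c 0\<close> by injectivity; the general request forces a copy of \<open>c 0\<close>
  somewhere.\<close>

lemma holders_block:
  assumes "inj c" "R \<subseteq> {1..k}" "\<forall>q \<in> set (block k c R). satisfies k C q"
  shows "holders k C (c 0) \<noteq> {}" "holders k C (c 0) \<subseteq> R"
    and "\<And>j. j \<in> {1..k} - R \<Longrightarrow> C j = Some (c j)"
proof -
  show "holders k C (c 0) \<noteq> {}" using assms(3) by (auto simp: set_block)
  show *: "\<And>j. j \<in> {1..k} - R \<Longrightarrow> C j = Some (c j)" using assms(3) by (auto simp: set_block)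
  show "holders k C (c 0) \<subseteq> R"
  proof
    fix j assume "j \<in> holders k C (c 0)"
    then have j: "j \<in> {1..k}" "C j = Some (c 0)" by auto
    show "j \<in> R"
    proof (rule ccontr)
      assume "j \<notin> R"
      then have "c j = c 0" using * j by auto
      then show False using assms(1) j by (auto dest: injD)
    qed
  qed
qed

text \<open>Shared by the first phase and the later ones. As \<open>c 0\<close> is absent after
  \<open>h0\<close>, each of its copies at a checkpoint \<open>h'\<close> has been paid for in
  between, which cancels the potential. What follows the checkpoint is left to the assumption
  \<open>checkpoint\<close>.\<close>

lemma phase_start_lower_bound:
  fixes A :: "'p online_alg" and c k N T h
  defines "h1 \<equiv> h @ blocks k N c {1..k}"
  assumes "serves k A" "k \<ge> 1" "request_sequence k h" "prefix h0 h"
    and "holders k (last_config (run A h0)) (c 0) = {}"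
    and "real (Suc T) * (2 * harm k - 1) \<le> real N"
    and checkpoint: "\<And>h'. prefix h' h1 \<Longrightarrow>
        \<forall>q \<in> set (block k c {1..k}). satisfies k (last_config (run A h')) q \<Longrightarrow>
        real (cost k (run A h')) + 2 * (harm k - 1) + 1
          - real (card (holders k (last_config (run A h')) (c 0))) + real T * (2 * harm k - 1)
        \<le> measure_pmf.expectation (adversary k N T (k - 1) c {1..k} h1) (\<lambda>\<sigma>. real (cost k (run A \<sigma>)))"
  shows "real (cost k (run A h0)) + real (Suc T) * (2 * harm k - 1)
    \<le> measure_pmf.expectation (adversary k N T (k - 1) c {1..k} h1) (\<lambda>\<sigma>. real (cost k (run A \<sigma>)))"
proof -
  let ?B = "block k c {1..k}"
  have rs: "request_sequence k ?B" by (auto simp: request_sequence_def set_block)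
  consider "cost k (run A h) + N \<le> cost k (run A h1)"
    | h' where "prefix h h'" "prefix h' h1" "\<forall>q \<in> set ?B. satisfies k (last_config (run A h')) q"
    using repeated_block[OF assms(2,4) rs, of N] unfolding h1_def blocks_def by blast
  then show ?thesis
  proof cases
    case 1
    have "request_sequence k h1" using assms(4) by (simp add: h1_def request_sequence_blocks)
    moreover have "real (cost k (run A h0)) + real (Suc T) * (2 * harm k - 1) \<le> real (cost k (run A h1))"
      using 1 cost_run_mono[OF assms(5), of k A] assms(7) by linarith
    ultimately show ?thesis
      using assms(3) by (intro adversary_expectation_ge) auto
  next
    case 2
    have "prefix h0 h'" using assms(5) 2(1) by auto
    then have "cost k (run A h0) + card (holders k (last_config (run A h')) (c 0)) \<le> cost k (run A h')"
      using card_holders_le_retrievals[OF assms(6), of "last_config (run A h')"]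
        cost_run_prefix[of h0 h' k A] by linarith
    moreover have "real (Suc T) * (2 * harm k - 1) = 2 * (harm k - 1) + 1 + real T * (2 * harm k - 1)"
      by (simp add: algebra_simps)
    ultimately show ?thesis using checkpoint[OF 2(2,3)] by linarith
  qed
qed

text \<open>The potential is the number of surplus copies of \<open>c 0\<close> in the cache: each costs one
  retrieval and saves at most one later. The history \<open>h0\<close> is a checkpoint inside the last
  repeated block; if there is none, the block alone costs \<open>N\<close>, which exceeds the bound.\<close>

lemma adversary_lower_bound:
  fixes A :: "'p online_alg"
  assumes "serves k A" "k \<ge> 1" "R \<subseteq> {1..k}" "card R = Suc r" "request_sequence k h" "inj c"
    and "prefix h0 h" "\<forall>q \<in> set (block k c R). satisfies k (last_config (run A h0)) q"
    and "2 * harm k + real T * (2 * harm k - 1) \<le> real N"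
  shows "real (cost k (run A h0)) + 2 * (harm (Suc r) - 1) + 1
      - real (card (holders k (last_config (run A h0)) (c 0))) + real T * (2 * harm k - 1)
    \<le> measure_pmf.expectation (adversary k N T r c R h) (\<lambda>\<sigma>. real (cost k (run A \<sigma>)))"
  using assms
proof (induction k N T r c R h arbitrary: h0 rule: adversary.induct)
  case (1 k N T r c R h)
  note prems = 1(2-10)
  let ?S = "holders k (last_config (run A h0)) (c 0)"
  let ?f = "\<lambda>\<sigma>. real (cost k (run A \<sigma>))"
  let ?P = "\<lambda>j. adversary k N T r c (R - {j}) (h @ blocks k N c (R - {j}))"
  \<comment> \<open>This is the claimed bound with \<open>harm (Suc r)\<close> in place of
    \<open>harm (Suc (Suc r))\<close>; the random choice of \<open>j\<close> has to make up the
    difference \<open>2 / (r + 2)\<close>.\<close>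
  define v where "v = ?f h0 + 2 * (harm (Suc r) - 1) + 1 - real (card ?S) + real T * (2 * harm k - 1)"
  have R: "finite R" "R \<noteq> {}" using prems(3,4) by (auto intro: finite_subset)
  note hb = holders_block[OF prems(6,3,8)]
  have S1: "card ?S \<ge> 1" using hb(1) by (simp add: Suc_le_eq card_gt_0_iff)
  have "Suc r \<le> k" using card_mono[OF _ prems(3)] prems(4) by simp
  then have harm_le: "harm (Suc r) \<le> (harm k :: real)" by (intro harm_mono)
  have step: "v + 2 * of_bool (j \<in> ?S) \<le> measure_pmf.expectation (?P j) ?f" if j: "j \<in> R" for j
  proof -
    let ?B = "block k c (R - {j})"
    have R': "R - {j} \<subseteq> {1..k}" "card (R - {j}) = Suc r" using prems(3,4) R j by auto
    have rs: "request_sequence k ?B" by (auto simp: request_sequence_def set_block)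
    have rs': "request_sequence k (h @ blocks k N c (R - {j}))"
      using prems(5) by (simp add: request_sequence_blocks)
    consider "cost k (run A h) + N \<le> cost k (run A (h @ blocks k N c (R - {j})))"
      | h' where "prefix h h'" "prefix h' (h @ blocks k N c (R - {j}))"
          "\<forall>q \<in> set ?B. satisfies k (last_config (run A h')) q"
      using repeated_block[OF prems(1,5) rs, of N] unfolding blocks_def by blast
    then show ?thesis
    proof cases
      case 1
      \<comment> \<open>Since \<open>card ?S\<close> is at least 1, it absorbs the summand 1 in
        \<open>v\<close>; the term \<open>2 * harm k\<close> in the bound on \<open>N\<close> covers
        the remaining harmonic part and the gain 2.\<close>
      have "v + 2 * of_bool (j \<in> ?S) \<le> ?f h0 + real N"
        using S1 harm_le prems(9) unfolding v_def by (auto simp: of_bool_def)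
      also have "\<dots> \<le> ?f (h @ blocks k N c (R - {j}))"
        using 1 cost_run_mono[OF prems(7), of k A] by linarith
      finally show ?thesis
        by (intro adversary_expectation_ge[OF prems(2) R' rs'])
    next
      case 2
      have "prefix h0 h'" using prems(7) 2(1) by auto
      \<comment> \<open>Slot \<open>j\<close> has just left the set of unrequested slots, so the new
        block forces \<open>c j\<close> into it.\<close>
      have jk: "j \<in> {1..k} - (R - {j})" using j prems(3) by auto
      have "c j \<noteq> c 0" using prems(6) jk by (auto dest: injD)
      then have "card (holders k (last_config (run A h')) (c 0)) + 2 * of_bool (j \<in> ?S)
          \<le> retrievals k (last_config (run A h0)) (last_config (run A h')) + card ?S"
        using jk holders_block(3)[OF prems(6) R'(1) 2(3) jk]
        by (intro retrievals_ge_holders[where q = "c j"]) auto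
      then have "?f h0 + real (card (holders k (last_config (run A h')) (c 0))) + 2 * of_bool (j \<in> ?S)
          \<le> ?f h' + card ?S"
        using cost_run_prefix[OF \<open>prefix h0 h'\<close>, of k A] by (auto simp: of_bool_def split: if_splits)
      moreover have "?f h' + 2 * (harm (Suc r) - 1) + 1
            - real (card (holders k (last_config (run A h')) (c 0))) + real T * (2 * harm k - 1)
          \<le> measure_pmf.expectation (?P j) ?f"
        using 1(1)[of j h'] j R prems(1,2,6,9) R' rs' 2 by simp
      ultimately show ?thesis unfolding v_def by linarith
    qed
  qed
  have "(\<Sum>j\<in>R. v + 2 * of_bool (j \<in> ?S)) = real (Suc (Suc r)) * v + 2 * (\<Sum>j\<in>R. of_bool (j \<in> ?S))"
    using prems(4) by (simp add: sum.distrib sum_distrib_left)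
  also have "(\<Sum>j\<in>R. of_bool (j \<in> ?S)) = real (card (R \<inter> ?S))"
    using R by (simp add: of_bool_def sum.If_cases Int_def)
  \<comment> \<open>All copies of \<open>c 0\<close> lie in \<open>R\<close>, so the uniform choice
    hits one with probability \<open>card ?S / (r + 2)\<close>, which is at least
    \<open>1 / (r + 2)\<close>.\<close>
  also have "R \<inter> ?S = ?S" using hb(2) by blast
  finally have sum_v: "(\<Sum>j\<in>R. v + 2 * of_bool (j \<in> ?S)) = real (Suc (Suc r)) * v + 2 * real (card ?S)" .
  have "harm (Suc (Suc r)) = harm (Suc r) + 1 / real (Suc (Suc r))"
    by (subst harm_Suc) (simp only: inverse_eq_divide)
  then have "?f h0 + 2 * (harm (Suc (Suc r)) - 1) + 1 - real (card ?S) + real T * (2 * harm k - 1)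
      = v + 2 * 1 / real (Suc (Suc r))"
    unfolding v_def by simp
  also have "\<dots> \<le> v + 2 * real (card ?S) / real (Suc (Suc r))"
    using S1 by (intro add_left_mono divide_right_mono mult_left_mono) auto
  also have "\<dots> = (\<Sum>j\<in>R. v + 2 * of_bool (j \<in> ?S)) / real (Suc (Suc r))"
    unfolding sum_v by (simp add: add_divide_distrib del: of_nat_Suc)
  also have "\<dots> \<le> (\<Sum>j\<in>R. measure_pmf.expectation (?P j) ?f) / real (Suc (Suc r))"
    by (intro divide_right_mono sum_mono step) auto
  also have "\<dots> = measure_pmf.expectation (adversary k N T (Suc r) c R h) ?f"
  proof -
    have fin: "finite (set_pmf (?P j))" if "j \<in> R" for j
      using adversary_support[of k "R - {j}" r "h @ blocks k N c (R - {j})" N T c] that R prems(2-5)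
      by (auto simp: request_sequence_blocks)
    have "measure_pmf.expectation (adversary k N T (Suc r) c R h) ?f
        = (\<Sum>j\<in>R. measure_pmf.expectation (?P j) ?f /\<^sub>R real (card R))"
      unfolding adversary.simps using R fin by (intro pmf_expectation_bind_pmf_of_set) auto
    then show ?thesis
      unfolding prems(4) by (simp add: sum_distrib_left divide_inverse mult.commute del: of_nat_Suc)
  qed
  finally show ?case .
next
  case (2 k N c R h)
  \<comment> \<open>With one slot left and no further phase, the harmonic term vanishes and the
    summand 1 is cancelled by a copy of \<open>c 0\<close>.\<close>
  have "card (holders k (last_config (run A h0)) (c 0)) \<ge> 1"
    using holders_block(1)[OF 2(6,3,8)] by (simp add: Suc_le_eq card_gt_0_iff)
  then show ?case
    using cost_run_mono[OF 2(7), of k A] by (simp add: harm_expand)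
next
  case (3 k N T c R h)
  note prems = 3(2-10)
  let ?f = "\<lambda>\<sigma>. real (cost k (run A \<sigma>))"
  let ?C = "last_config (run A h0)"
  obtain s where s: "R = {s}" using prems(4) by (auto simp: card_Suc_eq)
  define c' where "c' = swap_in c s"
  define h1 where "h1 = h @ blocks k N c' {1..k}"
  have c': "inj c'" unfolding c'_def using prems(6) by (rule inj_swap_in)
  have adv: "adversary k N (Suc T) 0 c R h = adversary k N T (k - 1) c' {1..k} h1"
    by (simp add: s c'_def h1_def)
  have k: "Suc (k - 1) = k" using prems(2) by simp
  note hb = holders_block[OF prems(6,3,8)]
  \<comment> \<open>At the end of a phase the algorithm's cache is forced: \<open>c 0\<close> is in
    \<open>s\<close> and every other slot holds its own page. Hence the next phase's page
    \<open>c s\<close> is nowhere in the cache.\<close>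
  have hs: "holders k ?C (c 0) = {s}" using hb(1,2) s by blast
  have empty: "holders k ?C (c' 0) = {}"
  proof -
    have "?C j \<noteq> Some (c s)" if "j \<in> {1..k}" for j
    proof (cases "j = s")
      case True
      then have "?C j = Some (c 0)" using hs by auto
      moreover have "c 0 \<noteq> c s" using prems(3,6) s by (auto dest: injD)
      ultimately show ?thesis by simp
    next
      case False
      then show ?thesis using hb(3)[of j] that s prems(6) by (auto dest: injD)
    qed
    then show ?thesis by (auto simp: c'_def)
  qed
  have rs1: "request_sequence k h1"
    using prems(5) by (simp add: h1_def request_sequence_blocks)
  have k1: "{1..k} \<subseteq> {1..k}" "card {1..k} = Suc (k - 1)" using prems(2) by auto
  have "?f h0 + real (Suc T) * (2 * harm k - 1)
      \<le> measure_pmf.expectation (adversary k N T (k - 1) c' {1..k} h1) ?f"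
    unfolding h1_def
  proof (rule phase_start_lower_bound[where c = c', OF prems(1,2,5,7) empty])
    show "real (Suc T) * (2 * harm k - 1) \<le> real N"
      using prems(9) harm_ge_one[OF prems(2)] by linarith
    have "2 * harm k + real T * (2 * harm k - 1) \<le> real N"
      using prems(9) harm_ge_one[OF prems(2)] by (simp add: algebra_simps)
    then show "?f h' + 2 * (harm k - 1) + 1
          - real (card (holders k (last_config (run A h')) (c' 0))) + real T * (2 * harm k - 1)
        \<le> measure_pmf.expectation (adversary k N T (k - 1) c' {1..k} (h @ blocks k N c' {1..k})) ?f"
      if "prefix h' (h @ blocks k N c' {1..k})"
        "\<forall>q \<in> set (block k c' {1..k}). satisfies k (last_config (run A h')) q" for h'
      using 3(1)[of h'] prems(1,2) k1 rs1 c' that by (simp add: k s c'_def[symmetric] h1_def)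
  qed
  then show ?case unfolding adv hs by (simp add: harm_expand)
qed


section \<open>Cost of the optimal solution\<close>

definition full_config :: "(nat \<Rightarrow> 'p) \<Rightarrow> 'p config" where
  "full_config c s = Some (c s)"

text \<open>This bounds the work function of \<open>\<sigma>\<close> at \<open>C\<close> by
  \<open>x\<close>: the final move to \<open>C\<close> is included, so a change of configuration can
  be paid before the request that needs it.\<close>

definition reachable :: "nat \<Rightarrow> 'p request list \<Rightarrow> 'p config \<Rightarrow> nat \<Rightarrow> bool" where
  "reachable k \<sigma> C x \<longleftrightarrow>
     (\<exists>Cs. is_solution k \<sigma> Cs \<and> cost k Cs + retrievals k (last_config Cs) C \<le> x)"

lemma reachable_append:
  assumes "reachable k \<sigma> C x" "\<forall>q \<in> set B. satisfies k C q"
  shows "reachable k (\<sigma> @ B) C x"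
  using assms(2)
proof (induction B rule: rev_induct)
  case Nil
  then show ?case using assms(1) by simp
next
  case (snoc q B)
  then obtain Cs where Cs: "is_solution k (\<sigma> @ B) Cs" "cost k Cs + retrievals k (last_config Cs) C \<le> x"
    by (auto simp: reachable_def)
  have "is_solution k (\<sigma> @ B @ [q]) (Cs @ [C])"
    using Cs(1) snoc.prems unfolding is_solution_def append_assoc[symmetric]
    by (auto simp: nth_append less_Suc_eq simp del: append_assoc)
  moreover have "cost k (Cs @ [C]) + retrievals k (last_config (Cs @ [C])) C \<le> x"
    using Cs(2) by (simp add: cost_snoc)
  ultimately show ?case unfolding reachable_def by blast
qed

lemma reachable_switch:
  assumes "reachable k \<sigma> C x" "retrievals k C D \<le> y"
  shows "reachable k \<sigma> D (x + y)"
proof -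
  obtain Cs where "is_solution k \<sigma> Cs" "cost k Cs + retrievals k (last_config Cs) C \<le> x"
    using assms(1) by (auto simp: reachable_def)
  then show ?thesis
    using assms(2) retrievals_triangle[of k "last_config Cs" D C] unfolding reachable_def
    by (intro exI[of _ Cs]) auto
qed

lemma OPT_le_if_reachable:
  assumes "reachable k \<sigma> C x"
  shows "OPT k \<sigma> \<le> x"
proof -
  obtain Cs where "is_solution k \<sigma> Cs" "cost k Cs + retrievals k (last_config Cs) C \<le> x"
    using assms by (auto simp: reachable_def)
  then have "OPT k \<sigma> \<le> cost k Cs" unfolding OPT_def by (intro cInf_lower) auto
  with \<open>_ \<le> x\<close> show ?thesis by simp
qed

text \<open>Placing \<open>c 0\<close> in a slot \<open>s\<close> that is still in \<open>R\<close>
  disturbs no specific request of the block.\<close>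

lemma satisfies_blocks:
  assumes "s \<in> R" "R \<subseteq> {1..k}"
  shows "\<forall>q \<in> set (blocks k N c R). satisfies k (full_config (swap_in c s)) q"
proof -
  have "s \<in> {1..k}" using assms by blast
  moreover have "swap_in c s j = c j" if "j \<in> {1..k} - R" for j
  proof -
    have "j \<noteq> 0" "j \<noteq> s" using that assms by auto
    then show ?thesis by simp
  qed
  ultimately have "\<forall>q \<in> set (block k c R). satisfies k (full_config (swap_in c s)) q"
    by (auto simp: set_block full_config_def intro!: bexI[of _ s])
  moreover have "set (blocks k N c R) \<subseteq> set (block k c R)" by (auto simp: blocks_def)
  ultimately show ?thesis by blast
qed

text \<open>All slots of \<open>R\<close> are kept as candidates for holding \<open>c 0\<close>,
  each at the same cost \<open>x\<close>. The random order eliminates candidates without raising the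
  cost of the others, and the survivor starts the next phase.\<close>

lemma adversary_OPT:
  assumes "k \<ge> 1" "R \<subseteq> {1..k}" "card R = Suc r"
    and "\<forall>s \<in> R. reachable k h (full_config (swap_in c s)) x"
    and "\<sigma> \<in> set_pmf (adversary k N T r c R h)"
  shows "OPT k \<sigma> \<le> x + T"
  using assms
proof (induction k N T r c R h arbitrary: x rule: adversary.induct)
  case (1 k N T r c R h)
  have R: "finite R" "R \<noteq> {}" using 1(3,4) by (auto intro: finite_subset)
  then obtain j where j: "j \<in> R"
    "\<sigma> \<in> set_pmf (adversary k N T r c (R - {j}) (h @ blocks k N c (R - {j})))"
    using 1(6) by auto
  have "\<forall>s \<in> R - {j}. reachable k (h @ blocks k N c (R - {j})) (full_config (swap_in c s)) x"
  proof
    fix s assume s: "s \<in> R - {j}"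
    show "reachable k (h @ blocks k N c (R - {j})) (full_config (swap_in c s)) x"
      using s 1(3,5) satisfies_blocks[OF s, of k N c] by (intro reachable_append) auto
  qed
  then show ?case using j R 1(2-4) by (intro 1(1)[of j]) auto
next
  case (2 k N c R h)
  then show ?case by (auto simp: card_Suc_eq intro: OPT_le_if_reachable)
next
  case (3 k N T c R h)
  obtain s where s: "R = {s}" using 3(4) by (auto simp: card_Suc_eq)
  define c' where "c' = swap_in c s"
  have "\<forall>s' \<in> {1..k}. reachable k (h @ blocks k N c' {1..k}) (full_config (swap_in c' s')) (x + 1)"
  proof
    fix s' assume s': "s' \<in> {1..k}"
    \<comment> \<open>Bringing in the next page changes slot \<open>s'\<close> only, so each new
      phase adds 1 to the cost.\<close>
    have "{j \<in> {1..k}. (full_config (swap_in c' s')) j \<noteq> None \<and>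
        (full_config (swap_in c' s')) j \<noteq> (full_config c') j} \<subseteq> {s'}"
      by (auto simp: full_config_def swap_in_def)
    then have "retrievals k (full_config c') (full_config (swap_in c' s')) \<le> card {s'}"
      unfolding retrievals_def by (intro card_mono) auto
    then have "retrievals k (full_config c') (full_config (swap_in c' s')) \<le> 1" by simp
    moreover have "reachable k h (full_config c') x" using 3(5) s by (simp add: c'_def)
    ultimately show "reachable k (h @ blocks k N c' {1..k}) (full_config (swap_in c' s')) (x + 1)"
      using satisfies_blocks[OF s', of k N c'] by (intro reachable_append reachable_switch) auto
  qed
  then have "OPT k \<sigma> \<le> (x + 1) + T"
    using 3(2,6) by (intro 3(1)) (auto simp: s c'_def)
  then show ?case by simp
qed

section \<open>Averaging and the competitive ratio\<close>

text \<open>The algorithm is charged for \<open>Suc T\<close> phases; \<open>OPT\<close> pays at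
  most \<open>k\<close> up to the end of the first and 1 for each of the \<open>T\<close> others.
  The ratio of the two bounds tends to \<open>2 * harm k - 1\<close> as \<open>T\<close>
  grows.\<close>

lemma expected_cost_lower_bound:
  fixes M :: "'w measure" and A :: "'w \<Rightarrow> 'p online_alg"
  assumes "infinite (UNIV :: 'p set)" "k \<ge> 1" "randomized_online_algorithm k M A"
  obtains \<sigma> where "request_sequence k \<sigma>" "OPT k \<sigma> \<le> k + T"
    "real (Suc T) * (2 * harm k - 1) \<le> expected_cost k M A \<sigma>"
proof -
  obtain c :: "nat \<Rightarrow> 'p" where c: "inj c"
    using infinite_countable_subset[OF assms(1)] by auto
  interpret prob_space M using assms(3) by (simp add: randomized_online_algorithm_def)
  define L :: real where "L = real (Suc T) * (2 * harm k - 1)"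
  obtain N :: nat where N: "2 * harm k + L \<le> real N" using real_arch_simple by blast
  define h where "h = blocks k N c {1..k}"
  define P where "P = adversary k N T (k - 1) c {1..k} h"
  have h: "request_sequence k h" by (simp add: h_def request_sequence_blocks)
  have k: "card {1..k} = Suc (k - 1)" using assms(2) by simp
  have supp: "finite (set_pmf P)" "\<And>\<sigma>. \<sigma> \<in> set_pmf P \<Longrightarrow> request_sequence k \<sigma>"
    using adversary_support[OF assms(2) subset_refl k h, of N T c] by (auto simp: P_def)
  \<comment> \<open>Any configuration can be loaded into the empty cache with at most
    \<open>k\<close> retrievals.\<close>
  have "reachable k [] (full_config (swap_in c s)) k" for s
    unfolding reachable_def by (intro exI[of _ "[]"]) (auto simp: is_solution_def retrievals_le)
  then have "\<forall>s \<in> {1..k}. reachable k h (full_config (swap_in c s)) k"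
    using reachable_append[OF _ satisfies_blocks[of _ "{1..k}" k N c], of "[]"] by (auto simp: h_def)
  then have opt: "OPT k \<sigma> \<le> k + T" if "\<sigma> \<in> set_pmf P" for \<sigma>
    using adversary_OPT[OF assms(2) subset_refl k] that by (auto simp: P_def)
  have sum_P: "measure_pmf.expectation P f = (\<Sum>\<sigma>\<in>set_pmf P. f \<sigma> * pmf P \<sigma>)" for f :: "_ \<Rightarrow> real"
    by (rule integral_measure_pmf_real) (use supp in auto)
  have L_le: "L \<le> measure_pmf.expectation P (\<lambda>\<sigma>. real (cost k (run (A \<omega>) \<sigma>)))" if "\<omega> \<in> space M" for \<omega>
  proof -
    have A: "serves k (A \<omega>)"
      using assms(3) that by (auto simp: randomized_online_algorithm_def serves_def)
    \<comment> \<open>The cache is empty before the first request, so the first phase can start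
      there with both histories empty.\<close>
    have "real (cost k (run (A \<omega>) [])) + real (Suc T) * (2 * harm k - 1)
      \<le> measure_pmf.expectation (adversary k N T (k - 1) c {1..k} ([] @ blocks k N c {1..k}))
          (\<lambda>\<sigma>. real (cost k (run (A \<omega>) \<sigma>)))"
    proof (rule phase_start_lower_bound[OF A assms(2)])
      show "real (Suc T) * (2 * harm k - 1) \<le> real N"
        using N harm_ge_one[OF assms(2)] unfolding L_def by linarith
      have N': "2 * harm k + real T * (2 * harm k - 1) \<le> real N"
        using N harm_ge_one[OF assms(2)] unfolding L_def by (simp add: algebra_simps)
      show "real (cost k (run (A \<omega>) h')) + 2 * (harm k - 1) + 1
          - real (card (holders k (last_config (run (A \<omega>) h')) (c 0))) + real T * (2 * harm k - 1)
        \<le> measure_pmf.expectation (adversary k N T (k - 1) c {1..k} ([] @ blocks k N c {1..k}))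
            (\<lambda>\<sigma>. real (cost k (run (A \<omega>) \<sigma>)))"
        if "prefix h' ([] @ blocks k N c {1..k})"
          "\<forall>q \<in> set (block k c {1..k}). satisfies k (last_config (run (A \<omega>) h')) q" for h'
        using adversary_lower_bound[OF A assms(2) subset_refl k h c _ that(2) N'] that(1) assms(2)
        by (simp add: h_def)
    qed (auto simp: request_sequence_def last_config_def)
    then show ?thesis by (simp add: L_def P_def h_def)
  qed
  have int: "integrable M (\<lambda>\<omega>. real (cost k (run (A \<omega>) \<sigma>)))" if "\<sigma> \<in> set_pmf P" for \<sigma>
  proof (rule integrable_const_bound)
    have "cost k (run (A \<omega>) \<tau>) \<le> k * length \<tau>" for \<omega> \<tau>
    proof (induction \<tau> rule: rev_induct)
      case (snoc r \<tau>)
      then show ?case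
        using retrievals_le[of k "last_config (run (A \<omega>) \<tau>)" "A \<omega> (\<tau> @ [r])"]
        by (simp add: run_snoc cost_snoc)
    qed simp
    then show "AE \<omega> in M. norm (real (cost k (run (A \<omega>) \<sigma>))) \<le> real (k * length \<sigma>)"
      by (simp del: of_nat_mult)
    show "(\<lambda>\<omega>. real (cost k (run (A \<omega>) \<sigma>))) \<in> borel_measurable M"
      using assms(3) supp(2)[OF that] by (auto simp: randomized_online_algorithm_def)
  qed
  \<comment> \<open>The two expectations are exchanged, the inner one being a finite sum.\<close>
  have "L \<le> (\<integral>\<omega>. (\<Sum>\<sigma>\<in>set_pmf P. real (cost k (run (A \<omega>) \<sigma>)) * pmf P \<sigma>) \<partial>M)"
    using L_le int unfolding sum_P by (intro integral_ge_const) (auto intro!: AE_I2)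
  also have "\<dots> = (\<Sum>\<sigma>\<in>set_pmf P. expected_cost k M A \<sigma> * pmf P \<sigma>)"
    unfolding expected_cost_def using int by (subst Bochner_Integration.integral_sum) auto
  finally have avg: "L \<le> (\<Sum>\<sigma>\<in>set_pmf P. expected_cost k M A \<sigma> * pmf P \<sigma>)" .
  have "\<exists>\<sigma>\<in>set_pmf P. L \<le> expected_cost k M A \<sigma>"
  proof (rule ccontr)
    assume "\<not> ?thesis"
    then have "(\<Sum>\<sigma>\<in>set_pmf P. expected_cost k M A \<sigma> * pmf P \<sigma>) < (\<Sum>\<sigma>\<in>set_pmf P. L * pmf P \<sigma>)"
      using supp(1) set_pmf_not_empty[of P]
      by (intro sum_strict_mono mult_strict_right_mono) (auto simp: pmf_positive)
    also have "\<dots> = L"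
      using supp(1) by (simp add: sum_pmf_eq_1 flip: sum_distrib_left)
    finally show False using avg by simp
  qed
  then show ?thesis using that supp(2) opt unfolding L_def by blast
qed

theorem theorem7:
  fixes k :: nat
    and M :: "'w measure"
    and A :: "'w \<Rightarrow> 'p online_alg"
  assumes "infinite (UNIV :: 'p set)"
    and "k \<ge> 1"
    and "randomized_online_algorithm k M A"
  shows "competitive_ratio k M A \<ge> ereal (2 * harm k - 1)"
proof -
  let ?a = "2 * harm k - 1 :: real"
  have "?a \<le> c" if comp: "competitive k M A c" for c
  proof (rule ccontr)
    assume "\<not> ?a \<le> c"
    \<comment> \<open>A nonnegative factor is needed to insert the upper bound on
      \<open>OPT\<close>; it stays below \<open>?a\<close> because \<open>?a\<close> is at least
      1.\<close>
    define d where "d = max c 0"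
    have d: "d < ?a" "c \<le> d" "0 \<le> d"
      using \<open>\<not> ?a \<le> c\<close> harm_ge_one[OF assms(2)] by (auto simp: d_def)
    obtain b where b: "\<And>\<sigma>. request_sequence k \<sigma> \<Longrightarrow> expected_cost k M A \<sigma> \<le> c * real (OPT k \<sigma>) + b"
      using comp unfolding competitive_def by blast
    \<comment> \<open>The number of phases is chosen so that the gap \<open>?a - d\<close> per phase
      outweighs the additive constant \<open>b\<close> and the initial cost
      \<open>k\<close>.\<close>
    obtain T :: nat where "d * real k + b < real T * (?a - d)"
      using reals_Archimedean3[of "?a - d"] d(1) by auto
    obtain \<sigma> where \<sigma>: "request_sequence k \<sigma>" "OPT k \<sigma> \<le> k + T"
        "real (Suc T) * ?a \<le> expected_cost k M A \<sigma>"
      using expected_cost_lower_bound[OF assms] by blast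
    have "real T * ?a \<le> real (Suc T) * ?a"
      using d by (intro mult_right_mono) auto
    also have "\<dots> \<le> c * real (OPT k \<sigma>) + b" using \<sigma> b by force
    also have "c * real (OPT k \<sigma>) \<le> d * real (OPT k \<sigma>)" using d by (intro mult_right_mono) auto
    also have "\<dots> \<le> d * real (k + T)" using d \<sigma>(2) by (intro mult_left_mono) auto
    finally show False
      using \<open>d * real k + b < real T * (?a - d)\<close> by (simp add: algebra_simps)
  qed
  then show ?thesis
    unfolding competitive_ratio_def by (intro Inf_greatest) auto
qed

end
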